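(* Let $\psi(k)\ge 0$, $k=1,2,\dots$, with $\sum_{k=1}^{\infty}k\psi(k)<\infty$, and let $\beta\in\mathbb{R}$. Then for all $n\in\mathbb{N}$ $$\mathcal{E}_{n}(C^{\psi}_{\beta,1})_{C}=\frac1\pi\sum_{k=n}^{\infty}\psi(k)+\frac{\Theta_2}{n}\sum_{k=1}^{\infty}k\psi(k+n),$$ where the quantity $\Theta_2=\Theta_2(n,\beta,\psi)$ satisfies $-1\le\Theta_2\le0$.
   Context: All functions are real-valued and $2\pi$-periodic; $\mathbb{N}=\{1,2,\dots\}$. $L_1$ is the space of $2\pi$-periodic functions summable on $[0,2\pi)$ with norm $\|f\|_1=\int_0^{2\pi}|f(t)|\,dt$; $C$ is the space of continuous $2\pi$-periodic functions with norm $\|f\|_C=\max_t|f(t)|$. For a sequence $\psi(k)\ge0$ with $\sum_{k=1}^\infty\psi(k)<\infty$ and $\beta\in\mathbb{R}$, put $\Psi_\beta(t)=\sum_{k=1}^{\infty}\psi(k)\cos\left(kt-\frac{\beta\pi}{2}\right)$. $C^{\psi}_{\beta,1}$ is the set of $2\pi$-periodic functions $f$ which for all $x\in\mathbb{R}$ have the form $$f(x)=\frac{a_0}{2}+\frac1\pi\int_{-\pi}^{\pi}\Psi_\beta(x-t)\varphi(t)\,dt,\qquad a_0\in\mathbb{R},\ \varphi\in L_1,\ \|\varphi\|_1\le1,\ \int_{-\pi}^{\pi}\varphi(t)\,dt=0.$$ $S_{n-1}(f;\cdot)$ is the partial Fourier sum of $f$ of order $n-1$, and $\mathcal{E}_{n}(C^{\psi}_{\beta,1})_{C}=\sup_{f\in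 C^{\psi}_{\beta,1}}\|f(\cdot)-S_{n-1}(f;\cdot)\|_C$. *)

theory Defs
  imports "HOL-Analysis.Analysis" "HOL-Library.Periodic_Fun"
begin

definition L1_space :: "(real \<Rightarrow> real) set" where
  "L1_space = {\<phi>. periodic_fun_simple \<phi> (2 * pi) \<and> set_integrable lebesgue {0..<2 * pi} \<phi>}"

definition L1_norm :: "(real \<Rightarrow> real) \<Rightarrow> real" where
  "L1_norm \<phi> = (LINT t:{0..<2 * pi}|lebesgue. \<bar>\<phi> t\<bar>)"

text \<open>For a continuous periodic function the supremum is finite and attained, so this is
  the maximum norm.\<close>

definition C_norm :: "(real \<Rightarrow> real) \<Rightarrow> real" where
  "C_norm g = (SUP t. \<bar>g t\<bar>)"

text \<open>Sequences indexed by \<open>k = 1, 2, \<dots>\<close> are functions on all of \<^typ>\<open>nat\<close> whose value at 0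
  is never used.\<close>

definition Psi_kernel :: "(nat \<Rightarrow> real) \<Rightarrow> real \<Rightarrow> real \<Rightarrow> real" where
  "Psi_kernel \<psi> \<beta> t = (\<Sum>k. \<psi> (Suc k) * cos (real (Suc k) * t - \<beta> * pi / 2))"

definition C_class :: "(nat \<Rightarrow> real) \<Rightarrow> real \<Rightarrow> (real \<Rightarrow> real) set" where
  "C_class \<psi> \<beta> = {f. periodic_fun_simple f (2 * pi) \<and>
     (\<exists>a0 \<phi>. \<phi> \<in> L1_space \<and> L1_norm \<phi> \<le> 1 \<and> (LINT t:{-pi..pi}|lebesgue. \<phi> t) = 0 \<and>
       (\<forall>x. f x = a0 / 2 + 1 / pi * (LINT t:{-pi..pi}|lebesgue. Psi_kernel \<psi> \<beta> (x - t) * \<phi> t)))}"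

definition fourier_cos_coeff :: "(real \<Rightarrow> real) \<Rightarrow> nat \<Rightarrow> real" where
  "fourier_cos_coeff f k = 1 / pi * (LINT t:{-pi..pi}|lebesgue. f t * cos (real k * t))"

definition fourier_sin_coeff :: "(real \<Rightarrow> real) \<Rightarrow> nat \<Rightarrow> real" where
  "fourier_sin_coeff f k = 1 / pi * (LINT t:{-pi..pi}|lebesgue. f t * sin (real k * t))"

definition fourier_sum :: "nat \<Rightarrow> (real \<Rightarrow> real) \<Rightarrow> real \<Rightarrow> real" where
  "fourier_sum m f x = fourier_cos_coeff f 0 / 2 +
     (\<Sum>k=1..m. fourier_cos_coeff f k * cos (real k * x) + fourier_sin_coeff f k * sin (real k * x))"

text \<open>The supremum is taken in \<^typ>\<open>ereal\<close>, so that an equation with a real number includes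
  its finiteness. Intended for \<open>n \<ge> 1\<close>.\<close>

definition fourier_error :: "nat \<Rightarrow> (real \<Rightarrow> real) set \<Rightarrow> ereal" where
  "fourier_error n F = (SUP f\<in>F. ereal (C_norm (\<lambda>x. f x - fourier_sum (n - 1) f x)))"

end

theory Submission
  imports Defs
begin

text \<open>For \<open>f\<close> in the class with density \<open>\<phi>\<close>, the remainder \<open>f - S\<^sub>n\<^sub>-\<^sub>1 f\<close> is \<open>1 / \<pi>\<close> times the
  convolution of \<open>\<phi>\<close> with the tail \<open>g(t) = \<Sum>\<^sub>k\<^sub>\<ge>\<^sub>n \<psi>(k) cos (k t - \<beta> \<pi> / 2)\<close> of the kernel
  (lemma \<open>fourier_remainder\<close>, where the convolution is kept as a sum of harmonics). Write
  \<open>S = \<Sum>\<^sub>k\<^sub>\<ge>\<^sub>n \<psi>(k)\<close> and \<open>T = \<Sum>\<^sub>k\<^sub>\<ge>\<^sub>1 k \<psi>(k + n)\<close>. Since \<open>\<bar>g\<bar> \<le> S\<close> and the norm of \<open>\<phi>\<close> is at most 1,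
  the error is at most \<open>S / \<pi>\<close>.

  For the lower bound, \<open>\<phi>\<close> approximates half the difference of two point masses, so the error is at
  least \<open>(g(x) - g(y)) / (2\<pi>)\<close> up to sign, for all \<open>x\<close> and \<open>y\<close>. Take for \<open>x\<close> and \<open>y = x - \<pi> / n\<close> the two
  extremal points of the leading harmonic \<open>cos (n t - \<beta> \<pi> / 2)\<close> that surround 0. There the harmonic
  of order \<open>n + k\<close> is, up to the alternating sign of the leading one, \<open>cos (k x)\<close> and \<open>cos (k y)\<close>, and
  \<open>cos z \<ge> 1 - \<bar>z\<bar>\<close> loses on average only \<open>k (\<bar>x\<bar> + \<bar>y\<bar>) / 2 = k \<pi> / (2n)\<close> (lemmas
  \<open>opposite_phase_points\<close> and \<open>cos_moments_of_bump\<close>). Summation gives the lower bound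
  \<open>S / \<pi> - T / (2n)\<close>, where the deviation from \<open>S / \<pi>\<close> is only half of \<open>T / n\<close>.\<close>

section \<open>Integrals over one period\<close>

lemma periodic_integral_shift:
  fixes f :: "real \<Rightarrow> real"
  assumes per: "\<And>x. f (x + 2 * pi) = f x" and int: "f integrable_on {0..2 * pi}"
  shows "f integrable_on {-pi..pi}" and "integral {-pi..pi} f = integral {0..2 * pi} f"
proof -
  have shift: "f \<circ> (+) (2 * pi) = f"
    using per by (auto simp: fun_eq_iff add.commute)
  have right: "f integrable_on {pi..2 * pi}" and mid: "f integrable_on {0..pi}"
    using int by (auto intro: integrable_subinterval_real)
  have left: "f integrable_on {-pi..0}"
    using integrable_on_shift_Icc_real[of f "2 * pi" "-pi" 0] right by (simp add: shift)
  show "f integrable_on {-pi..pi}"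
    by (rule Henstock_Kurzweil_Integration.integrable_combine[OF _ _ left mid]) auto
  then have "integral {-pi..pi} f = integral {-pi..0} f + integral {0..pi} f"
    by (subst Henstock_Kurzweil_Integration.integral_combine) auto
  also have "integral {-pi..0} f = integral {pi..2 * pi} f"
    using integral_shift_Icc_real[of "-pi" 0 f "2 * pi"] by (simp add: shift)
  also have "integral {pi..2 * pi} f + integral {0..pi} f = integral {0..2 * pi} f"
    using int by (subst add.commute, subst Henstock_Kurzweil_Integration.integral_combine) auto
  finally show "integral {-pi..pi} f = integral {0..2 * pi} f" .
qed

text \<open>The space and its norm are given on \<open>[0, 2\<pi>)\<close>, while the convolutions and the Fourier
  coefficients integrate over \<open>[-\<pi>, \<pi>]\<close>. The change of interval is made for the
  Henstock-Kurzweil integrals of \<open>\<phi>\<close> and \<open>\<bar>\<phi>\<bar>\<close> separately; absolute integrability on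
  \<open>[-\<pi>, \<pi>]\<close> is the existence of both.\<close>

lemma L1_space_on_symmetric_interval:
  assumes "\<phi> \<in> L1_space"
  shows "set_integrable lebesgue {-pi..pi} \<phi>"
    and "(LINT t:{-pi..pi}|lebesgue. \<bar>\<phi> t\<bar>) = L1_norm \<phi>"
proof -
  interpret periodic_fun_simple \<phi> "2 * pi"
    using assms by (simp add: L1_space_def)
  have int: "set_integrable lebesgue {0..<2 * pi} \<phi>"
    using assms by (simp add: L1_space_def)
  then have abs: "set_integrable lebesgue {0..<2 * pi} (\<lambda>t. \<bar>\<phi> t\<bar>)"
    by (rule set_integrable_abs)
  have null: "negligible ({0..<2 * pi} - {0..2 * pi})" "negligible ({0..2 * pi} - {0..<2 * pi})"
    by (auto intro: negligible_subset[of "{2 * pi}"])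
  have closed: "f integrable_on {0..2 * pi}" "integral {0..<2 * pi} f = integral {0..2 * pi} f"
    if "f integrable_on {0..<2 * pi}" for f :: "real \<Rightarrow> real"
    using that null
    by (auto intro!: integral_spike_set elim!: integrable_spike_set intro: negligible_subset)
  note HK = set_lebesgue_integral_eq_integral(1)
  have \<phi>: "\<phi> integrable_on {-pi..pi}"
    by (intro periodic_integral_shift closed HK int plus_period)
  have abs_\<phi>: "(\<lambda>t. \<bar>\<phi> t\<bar>) integrable_on {-pi..pi}"
    by (intro periodic_integral_shift closed HK abs) (simp add: plus_period)
  show si: "set_integrable lebesgue {-pi..pi} \<phi>"
    using \<phi> abs_\<phi> by (simp add: absolutely_integrable_on_def)
  have "(LINT t:{-pi..pi}|lebesgue. \<bar>\<phi> t\<bar>) = integral {-pi..pi} (\<lambda>t. \<bar>\<phi> t\<bar>)"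
    by (intro set_lebesgue_integral_eq_integral(2) set_integrable_abs si)
  also have "\<dots> = integral {0..2 * pi} (\<lambda>t. \<bar>\<phi> t\<bar>)"
    by (intro periodic_integral_shift closed HK abs) (simp add: plus_period)
  also have "\<dots> = integral {0..<2 * pi} (\<lambda>t. \<bar>\<phi> t\<bar>)"
    by (intro closed(2)[symmetric] HK abs)
  also have "\<dots> = L1_norm \<phi>"
    unfolding L1_norm_def by (intro set_lebesgue_integral_eq_integral(2)[symmetric] abs)
  finally show "(LINT t:{-pi..pi}|lebesgue. \<bar>\<phi> t\<bar>) = L1_norm \<phi>" .
qed

lemma set_integrable_continuous_mult:
  fixes u \<phi> :: "real \<Rightarrow> real"
  assumes u: "continuous_on {-pi..pi} u" and \<phi>: "set_integrable lebesgue {-pi..pi} \<phi>"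
  shows "set_integrable lebesgue {-pi..pi} (\<lambda>t. u t * \<phi> t)"
proof (rule absolutely_integrable_bounded_measurable_product_real[OF _ _ _ \<phi>])
  show "u \<in> borel_measurable (lebesgue_on {-pi..pi})"
    by (rule continuous_imp_measurable_on_sets_lebesgue[OF u]) auto
  show "bounded (u ` {-pi..pi})"
    by (intro compact_imp_bounded compact_continuous_image u) auto
qed auto

lemma integral_mult_bound:
  fixes u \<phi> :: "real \<Rightarrow> real"
  assumes u: "continuous_on {-pi..pi} u" and \<phi>: "set_integrable lebesgue {-pi..pi} \<phi>"
    and bound: "\<And>t. \<bar>u t\<bar> \<le> M"
  shows "\<bar>LINT t:{-pi..pi}|lebesgue. u t * \<phi> t\<bar> \<le> M * (LINT t:{-pi..pi}|lebesgue. \<bar>\<phi> t\<bar>)"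
proof -
  have "\<bar>LINT t:{-pi..pi}|lebesgue. u t * \<phi> t\<bar> \<le> (LINT t:{-pi..pi}|lebesgue. \<bar>u t * \<phi> t\<bar>)"
    using set_integral_norm_bound[OF set_integrable_continuous_mult[OF u \<phi>]] by simp
  also have "\<dots> \<le> (LINT t:{-pi..pi}|lebesgue. M * \<bar>\<phi> t\<bar>)"
    by (intro set_integral_mono set_integrable_abs set_integrable_mult_right
          set_integrable_continuous_mult u \<phi>)
       (simp add: abs_mult mult_right_mono bound)
  finally show ?thesis by simp
qed

text \<open>A series dominated by a convergent numerical series may be integrated termwise against any
  integrable weight. This is used twice: for the kernel against the density, and, with a
  trigonometric weight, for the Fourier coefficients of the resulting function.\<close>

lemma integral_suminf_mult:
  fixes u :: "nat \<Rightarrow> real \<Rightarrow> real" and \<phi> :: "real \<Rightarrow> real"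
  assumes u: "\<And>k. continuous_on {-pi..pi} (u k)" and \<phi>: "set_integrable lebesgue {-pi..pi} \<phi>"
    and bound: "\<And>k t. \<bar>u k t\<bar> \<le> M k" and M: "summable M"
  shows "(LINT t:{-pi..pi}|lebesgue. (\<Sum>k. u k t) * \<phi> t)
    = (\<Sum>k. LINT t:{-pi..pi}|lebesgue. u k t * \<phi> t)"
proof -
  let ?i = "indicat_real {-pi..pi}"
  have sum_u: "summable (\<lambda>k. \<bar>u k t\<bar>)" for t
    by (rule summable_comparison_test'[OF M, of 0]) (simp add: bound)
  have "(LINT t:{-pi..pi}|lebesgue. (\<Sum>k. u k t) * \<phi> t)
    = (LINT t|lebesgue. (\<Sum>k. ?i t * (u k t * \<phi> t)))"
    unfolding set_lebesgue_integral_def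
    using sum_u
    by (intro Bochner_Integration.integral_cong refl)
      (simp add: suminf_mult suminf_mult2 summable_mult summable_mult2 summable_rabs_cancel)
  also have "\<dots> = (\<Sum>k. LINT t|lebesgue. ?i t * (u k t * \<phi> t))"
  proof (rule integral_suminf)
    show "integrable lebesgue (\<lambda>t. ?i t * (u k t * \<phi> t))" for k
      using set_integrable_continuous_mult[OF u \<phi>] by (simp add: set_integrable_def)
    show "AE t in lebesgue. summable (\<lambda>k. norm (?i t * (u k t * \<phi> t)))"
      using sum_u by (auto simp: abs_mult intro!: summable_mult summable_mult2)
    show "summable (\<lambda>k. LINT t|lebesgue. norm (?i t * (u k t * \<phi> t)))"
    proof (rule summable_comparison_test'[OF summable_mult2[OF M], of 0])
      fix k
      have "\<bar>LINT t:{-pi..pi}|lebesgue. \<bar>u k t\<bar> * \<bar>\<phi> t\<bar>\<bar> \<le> M k * (LINT t:{-pi..pi}|lebesgue. \<bar>\<bar>\<phi> t\<bar>\<bar>)"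
        by (rule integral_mult_bound)
           (auto intro!: continuous_on_rabs u bound set_integrable_abs \<phi>)
      then show "norm (LINT t|lebesgue. norm (?i t * (u k t * \<phi> t)))
          \<le> M k * (LINT t:{-pi..pi}|lebesgue. \<bar>\<phi> t\<bar>)"
        by (simp add: set_lebesgue_integral_def abs_mult)
    qed
  qed
  finally show ?thesis by (simp add: set_lebesgue_integral_def)
qed

section \<open>Fourier sums of dominated trigonometric series\<close>

lemma integral_cos_int_frequency:
  fixes m :: int
  assumes "m \<noteq> 0"
  shows "(LINT t:{-pi..pi}|lebesgue. cos (m * t + a)) = 0"
proof -
  have "((\<lambda>t. cos (m * t + a)) has_integral
      (sin (m * pi + a) / m - sin (m * (-pi) + a) / m)) {-pi..pi}"
    by (rule fundamental_theorem_of_calculus)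
      (use assms in \<open>auto intro!: derivative_eq_intros
          simp: has_real_derivative_iff_has_vector_derivative[symmetric]\<close>)
  moreover have "sin (m * pi + a) = sin (m * (-pi) + a)"
    using sin.plus_of_int[of "m * (-pi) + a" m] by (simp add: algebra_simps)
  ultimately have "integral {-pi..pi} (\<lambda>t. cos (m * t + a)) = 0"
    by (simp add: integral_unique)
  moreover have "set_integrable lebesgue {-pi..pi} (\<lambda>t. cos (m * t + a))"
    by (intro absolutely_integrable_continuous_real continuous_intros)
  ultimately show ?thesis
    by (simp add: set_lebesgue_integral_eq_integral)
qed

text \<open>Orthogonality with arbitrary phases: the phase \<open>-\<pi>/2\<close> turns a cosine into a sine, so this
  single formula covers all products of sines and cosines.\<close>

lemma integral_cos_mult_cos:
  fixes j k :: nat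
  shows "(LINT t:{-pi..pi}|lebesgue. cos (real k * t + a) * cos (real j * t + b))
    = (if k \<noteq> j then 0 else if k = 0 then 2 * pi * cos a * cos b else pi * cos (a - b))"
proof -
  let ?p = "\<lambda>t::real. cos (real_of_int (int k + int j) * t + (a + b))"
  let ?m = "\<lambda>t::real. cos (real_of_int (int k - int j) * t + (a - b))"
  have cont: "set_integrable lebesgue {-pi..pi} (\<lambda>t. cos (c * t + d))" for c d :: real
    by (intro absolutely_integrable_continuous_real continuous_intros)
  have "cos (real k * t + a) * cos (real j * t + b) = 1 / 2 * (?m t + ?p t)" for t
    by (simp add: cos_times_cos algebra_simps)
  then have "(LINT t:{-pi..pi}|lebesgue. cos (real k * t + a) * cos (real j * t + b))
    = 1 / 2 * ((LINT t:{-pi..pi}|lebesgue. ?m t) + (LINT t:{-pi..pi}|lebesgue. ?p t))"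
    using cont by (simp only: set_integral_mult_right set_integral_add(2))
  also have "(LINT t:{-pi..pi}|lebesgue. ?p t)
      = (if k = 0 \<and> j = 0 then 2 * pi * cos (a + b) else 0)"
    using integral_cos_int_frequency[of "int k + int j" "a + b"]
    by (auto simp: set_lebesgue_integral_def)
  also have "(LINT t:{-pi..pi}|lebesgue. ?m t) = (if k = j then 2 * pi * cos (a - b) else 0)"
    using integral_cos_int_frequency[of "int k - int j" "a - b"]
    by (auto simp: set_lebesgue_integral_def)
  also have "1 / 2 * ((if k = j then 2 * pi * cos (a - b) else 0)
        + (if k = 0 \<and> j = 0 then 2 * pi * cos (a + b) else 0))
    = (if k \<noteq> j then 0 else if k = 0 then 2 * pi * cos a * cos b else pi * cos (a - b))"
    by (auto simp: cos_add cos_diff field_simps)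
  finally show ?thesis .
qed

lemma abs_cos_sin_combination_le: "\<bar>a * cos s + b * sin s\<bar> \<le> \<bar>a\<bar> + \<bar>b\<bar>" for a b s :: real
proof -
  have "\<bar>a * cos s\<bar> \<le> \<bar>a\<bar>" "\<bar>b * sin s\<bar> \<le> \<bar>b\<bar>"
    by (simp_all add: abs_mult mult_left_le)
  then show ?thesis by linarith
qed

lemma integral_trig_series_mult_cos:
  fixes A B M :: "nat \<Rightarrow> real"
  assumes M: "summable M" and A: "\<And>k. \<bar>A k\<bar> \<le> M k" and B: "\<And>k. \<bar>B k\<bar> \<le> M k"
  shows "(LINT t:{-pi..pi}|lebesgue.
      (\<Sum>k. A k * cos (real k * t) + B k * sin (real k * t)) * cos (real j * t + a))
    = (if j = 0 then 2 * pi * A 0 * cos a else pi * (A j * cos a - B j * sin a))" (is "_ = ?R")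
proof -
  let ?u = "\<lambda>k t. A k * cos (real k * t) + B k * sin (real k * t)"
  let ?c = "\<lambda>t. cos (real j * t + a)"
  have "(LINT t:{-pi..pi}|lebesgue. (\<Sum>k. ?u k t) * ?c t)
    = (\<Sum>k. LINT t:{-pi..pi}|lebesgue. ?u k t * ?c t)"
  proof (rule integral_suminf_mult)
    show "\<bar>?u k t\<bar> \<le> 2 * M k" for k t
      using abs_cos_sin_combination_le[of "A k" "real k * t" "B k"] A[of k] B[of k] by linarith
    show "summable (\<lambda>k. 2 * M k)" using M by (rule summable_mult)
    show "set_integrable lebesgue {-pi..pi} ?c"
      by (intro absolutely_integrable_continuous_real continuous_intros)
  qed (intro continuous_intros)
  also have "(\<lambda>k. LINT t:{-pi..pi}|lebesgue. ?u k t * ?c t) = (\<lambda>k. if k = j then ?R else 0)"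
  proof
    fix k
    have int: "set_integrable lebesgue {-pi..pi} (\<lambda>t. cos (real k * t + d) * ?c t)" for d
      by (intro absolutely_integrable_continuous_real continuous_intros)
    have "?u k t * ?c t = A k * (cos (real k * t + 0) * ?c t)
        + B k * (cos (real k * t + (- pi / 2)) * ?c t)" for t
      using cos_diff[of "real k * t" "pi / 2"] by (simp add: algebra_simps)
    then have "(LINT t:{-pi..pi}|lebesgue. ?u k t * ?c t)
      = A k * (LINT t:{-pi..pi}|lebesgue. cos (real k * t + 0) * ?c t)
        + B k * (LINT t:{-pi..pi}|lebesgue. cos (real k * t + (- pi / 2)) * ?c t)"
      using int by (simp only: set_integral_mult_right set_integral_add(2) set_integrable_mult_right)
    then show "(LINT t:{-pi..pi}|lebesgue. ?u k t * ?c t) = (if k = j then ?R else 0)"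
      unfolding integral_cos_mult_cos by (auto simp: cos_diff algebra_simps)
  qed
  also have "(\<Sum>k. if k = j then ?R else 0) = ?R"
    by (rule sums_single[THEN sums_unique, symmetric])
  finally show ?thesis .
qed

text \<open>The constant term of \<open>f\<close> is carried by \<open>A 0\<close>; the factor \<open>1 / 2\<close> in the Fourier sum undoes the
  doubling of the zeroth coefficient, which makes the partial sums uniform in \<open>k\<close>.\<close>

lemma fourier_sum_trig_series:
  fixes A B M :: "nat \<Rightarrow> real"
  assumes M: "summable M" and A: "\<And>k. \<bar>A k\<bar> \<le> M k" and B: "\<And>k. \<bar>B k\<bar> \<le> M k"
    and f: "\<And>t. f t = (\<Sum>k. A k * cos (real k * t) + B k * sin (real k * t))"
  shows "fourier_sum m f x = (\<Sum>k\<le>m. A k * cos (real k * x) + B k * sin (real k * x))"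
proof -
  have c: "fourier_cos_coeff f k = (if k = 0 then 2 * A 0 else A k)" for k
    using integral_trig_series_mult_cos[OF M A B, of k 0] by (simp add: fourier_cos_coeff_def f)
  have "cos (real k * t + - pi / 2) = sin (real k * t)" for k t
    by (simp add: cos_diff)
  then have s: "fourier_sin_coeff f k = B k" if "k \<noteq> 0" for k
    using integral_trig_series_mult_cos[OF M A B, of k "- pi / 2"] that
    by (simp add: fourier_sin_coeff_def f)
  have "{..m} = insert 0 {1..m}" by auto
  then show ?thesis
    by (simp add: fourier_sum_def c s)
qed

section \<open>The remainder of the Fourier sum of a convolution\<close>

text \<open>Up to the factor \<open>\<psi> k / \<pi>\<close>, this is the \<open>k\<close>-th harmonic at \<open>x\<close> of the convolution of the
  kernel with \<open>\<phi>\<close>.\<close>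

definition cos_moment :: "real \<Rightarrow> (real \<Rightarrow> real) \<Rightarrow> nat \<Rightarrow> real \<Rightarrow> real" where
  "cos_moment \<beta> \<phi> k x = (LINT t:{-pi..pi}|lebesgue. cos (real k * (x - t) - \<beta> * pi / 2) * \<phi> t)"

lemma abs_cos_moment_le:
  assumes "set_integrable lebesgue {-pi..pi} \<phi>"
  shows "\<bar>cos_moment \<beta> \<phi> k x\<bar> \<le> (LINT t:{-pi..pi}|lebesgue. \<bar>\<phi> t\<bar>)"
  unfolding cos_moment_def
  by (rule order_trans[OF integral_mult_bound[where M = 1]])
     (auto intro!: continuous_intros assms)

lemma Psi_kernel_convolution:
  assumes \<psi>: "\<And>k. \<psi> (Suc k) \<ge> 0" and sum: "summable (\<lambda>k. \<psi> (Suc k))"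
    and \<phi>: "set_integrable lebesgue {-pi..pi} \<phi>"
  shows "(LINT t:{-pi..pi}|lebesgue. Psi_kernel \<psi> \<beta> (x - t) * \<phi> t)
    = (\<Sum>k. \<psi> (Suc k) * cos_moment \<beta> \<phi> (Suc k) x)"
proof -
  have "(LINT t:{-pi..pi}|lebesgue. Psi_kernel \<psi> \<beta> (x - t) * \<phi> t)
    = (\<Sum>k. LINT t:{-pi..pi}|lebesgue.
        \<psi> (Suc k) * cos (real (Suc k) * (x - t) - \<beta> * pi / 2) * \<phi> t)"
    unfolding Psi_kernel_def
  proof (rule integral_suminf_mult[OF _ \<phi> _ sum])
    show "\<bar>\<psi> (Suc k) * cos (real (Suc k) * (x - t) - \<beta> * pi / 2)\<bar> \<le> \<psi> (Suc k)" for k t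
      using \<psi>[of k] by (simp add: abs_mult mult_left_le)
  qed (intro continuous_intros)
  then show ?thesis by (simp add: cos_moment_def mult.assoc)
qed

text \<open>Integrating the kernel series termwise shows that \<open>f\<close> is a dominated trigonometric series whose
  \<open>k\<close>-th harmonic is \<open>\<psi> k / \<pi>\<close> times the cosine moment of the density. Its Fourier sum is then a
  partial sum of that series, and the remainder is the tail.\<close>

lemma fourier_remainder:
  assumes \<psi>: "\<And>k. \<psi> (Suc k) \<ge> 0" and sum: "summable (\<lambda>k. \<psi> (Suc k))"
    and \<phi>: "set_integrable lebesgue {-pi..pi} \<phi>" and "n \<ge> 1"
    and f: "\<And>x. f x = a0 / 2 + 1 / pi * (LINT t:{-pi..pi}|lebesgue. Psi_kernel \<psi> \<beta> (x - t) * \<phi> t)"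
  shows "f x - fourier_sum (n - 1) f x = 1 / pi * (\<Sum>k. \<psi> (k + n) * cos_moment \<beta> \<phi> (k + n) x)"
proof -
  define N where "N = (LINT t:{-pi..pi}|lebesgue. \<bar>\<phi> t\<bar>)"
  let ?C = "\<lambda>k. LINT t:{-pi..pi}|lebesgue. cos (real k * t + \<beta> * pi / 2) * \<phi> t"
  let ?D = "\<lambda>k. LINT t:{-pi..pi}|lebesgue. sin (real k * t + \<beta> * pi / 2) * \<phi> t"
  define A where "A k = (if k = 0 then a0 / 2 else \<psi> k / pi * ?C k)" for k
  define B where "B k = (if k = 0 then 0 else \<psi> k / pi * ?D k)" for k
  \<comment> \<open>The common majorant of both coefficient sequences.\<close>
  define M where "M k = (if k = 0 then \<bar>a0 / 2\<bar> else \<psi> k / pi * N)" for k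
  let ?u = "\<lambda>k x. A k * cos (real k * x) + B k * sin (real k * x)"
  have nonneg: "\<psi> k \<ge> 0" if "k \<noteq> 0" for k
    using \<psi>[of "k - 1"] that by simp
  have CD: "\<bar>?C k\<bar> \<le> N" "\<bar>?D k\<bar> \<le> N" for k
    unfolding N_def
    by (rule order_trans[OF integral_mult_bound[where M = 1]];
        auto intro!: continuous_intros \<phi>)+
  have AM: "\<bar>A k\<bar> \<le> M k" and BM: "\<bar>B k\<bar> \<le> M k" for k
    using CD[of k] nonneg[of k]
    by (auto simp: A_def B_def M_def abs_mult intro!: divide_right_mono mult_left_mono)
  have M: "summable M"
    by (subst summable_Suc_iff[symmetric])
      (simp add: M_def summable_mult2 summable_divide sum)
  have "cos_moment \<beta> \<phi> k x = cos (real k * x) * ?C k + sin (real k * x) * ?D k" for k x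
  proof -
    have "cos (real k * (x - t) - \<beta> * pi / 2) * \<phi> t
      = cos (real k * x) * (cos (real k * t + \<beta> * pi / 2) * \<phi> t)
        + sin (real k * x) * (sin (real k * t + \<beta> * pi / 2) * \<phi> t)" for t
      using cos_diff[of "real k * x" "real k * t + \<beta> * pi / 2"] by (simp add: algebra_simps)
    moreover have "set_integrable lebesgue {-pi..pi} (\<lambda>t. cos (real k * t + \<beta> * pi / 2) * \<phi> t)"
      "set_integrable lebesgue {-pi..pi} (\<lambda>t. sin (real k * t + \<beta> * pi / 2) * \<phi> t)"
      by (intro set_integrable_continuous_mult continuous_intros \<phi>)+
    ultimately show ?thesis
      unfolding cos_moment_def
      by (simp only: set_integral_mult_right set_integral_add(2) set_integrable_mult_right)
  qed
  then have u: "?u k x = 1 / pi * (\<psi> k * cos_moment \<beta> \<phi> k x)" if "k \<noteq> 0" for k x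
    using that by (simp add: A_def B_def algebra_simps)
  have "\<bar>?u k x\<bar> \<le> 2 * M k" for k x
    using abs_cos_sin_combination_le[of "A k" "real k * x" "B k"] AM[of k] BM[of k] by linarith
  then have summ: "summable (\<lambda>k. ?u k x)" for x
    by (intro summable_comparison_test'[OF summable_mult[OF M, of 2], of 0]) simp
  have "summable (\<lambda>k. 1 / pi * (\<psi> (Suc k) * cos_moment \<beta> \<phi> (Suc k) x))" for x
    using summ[of x, THEN summable_ignore_initial_segment, of 1] by (simp add: u del: of_nat_Suc)
  then have pull: "1 / pi * (\<Sum>k. \<psi> (Suc k) * cos_moment \<beta> \<phi> (Suc k) x) = (\<Sum>k. ?u (Suc k) x)" for x
    using u by (subst suminf_mult[symmetric]) (simp_all add: summable_cmult_iff del: of_nat_Suc)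
  have f_series: "f x = (\<Sum>k. ?u k x)" for x
    using suminf_split_head[OF summ[of x]] pull[of x]
    by (simp add: f Psi_kernel_convolution[OF \<psi> sum \<phi>] A_def[of 0] del: of_nat_Suc)
  have "fourier_sum (n - 1) f x = (\<Sum>k<n. ?u k x)"
    unfolding fourier_sum_trig_series[OF M AM BM f_series]
    using \<open>n \<ge> 1\<close> by (intro sum.cong) auto
  then have "f x - fourier_sum (n - 1) f x = (\<Sum>k. ?u (k + n) x)"
    using f_series[of x] suminf_split_initial_segment[OF summ[of x], of n] by simp
  also have "\<dots> = (\<Sum>k. 1 / pi * (\<psi> (k + n) * cos_moment \<beta> \<phi> (k + n) x))"
    using u \<open>n \<ge> 1\<close> by (simp del: of_nat_add)
  also have "\<dots> = 1 / pi * (\<Sum>k. \<psi> (k + n) * cos_moment \<beta> \<phi> (k + n) x)"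
  proof (rule suminf_mult)
    have "summable (\<lambda>k. 1 / pi * (\<psi> (k + n) * cos_moment \<beta> \<phi> (k + n) x))"
      using summ[of x, THEN summable_ignore_initial_segment, of n] u \<open>n \<ge> 1\<close>
      by (simp del: of_nat_add)
    then show "summable (\<lambda>k. \<psi> (k + n) * cos_moment \<beta> \<phi> (k + n) x)"
      by (simp add: summable_cmult_iff)
  qed
  finally show ?thesis .
qed

section \<open>A nearly extremal density\<close>

text \<open>The density is an approximation of half the difference of the point masses at \<open>0\<close> and at \<open>d\<close>:
  height \<open>1 / (2h)\<close> on an interval of length \<open>h\<close> and the opposite height on another. Both bumps are
  placed inside \<open>(0, d) \<subseteq> (0, \<pi>)\<close>, the second to the left of \<open>d\<close>, so that the same formula
  describes the periodic extension on \<open>[0, 2\<pi>)\<close> and on \<open>[-\<pi>, \<pi>]\<close>, even for \<open>d = \<pi>\<close>.\<close>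

lemma two_bump_function:
  assumes h: "0 < h" "2 * h \<le> d" and d: "d \<le> pi"
  obtains \<phi> where "\<phi> \<in> L1_space" "L1_norm \<phi> \<le> 1" "(LINT t:{-pi..pi}|lebesgue. \<phi> t) = 0"
    and "\<And>u c c'. continuous_on {-pi..pi} u \<Longrightarrow> (\<And>t. t \<in> {0<..<h} \<Longrightarrow> c \<le> u t) \<Longrightarrow>
      (\<And>t. t \<in> {d - h<..<d} \<Longrightarrow> u t \<le> c') \<Longrightarrow>
      (c - c') / 2 \<le> (LINT t:{-pi..pi}|lebesgue. u t * \<phi> t)"
proof -
  let ?A = "{0<..<h}" and ?B = "{d - h<..<d}"
  define step where "step \<alpha> \<gamma> t = \<alpha> * indicat_real ?A t + \<gamma> * indicat_real ?B t" for \<alpha> \<gamma> t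
  define \<phi> where "\<phi> t = step (1 / (2 * h)) (- 1 / (2 * h)) (t - 2 * pi * \<lfloor>t / (2 * pi)\<rfloor>)" for t
  have step: "set_integrable lebesgue S (step \<alpha> \<gamma>)"
      "(LINT t:S|lebesgue. step \<alpha> \<gamma> t) = (\<alpha> + \<gamma>) * h"
    if "{0..<pi} \<subseteq> S" for S \<alpha> \<gamma>
  proof -
    have "?A \<subseteq> {0..<pi}" "?B \<subseteq> {0..<pi}"
      using h d by auto
    with that have "?A \<subseteq> S" "?B \<subseteq> S"
      by blast+
    then have "(\<lambda>t. indicator S t *\<^sub>R step \<alpha> \<gamma> t) = step \<alpha> \<gamma>"
      by (auto simp: step_def indicator_def fun_eq_iff)
    moreover have int: "integrable lebesgue (\<lambda>t. a * indicat_real {p<..<q} t)" for a p q :: real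
      by (cases "p \<le> q") (auto intro!: integrable_mult_right integrable_real_indicator)
    ultimately show "set_integrable lebesgue S (step \<alpha> \<gamma>)"
      "(LINT t:S|lebesgue. step \<alpha> \<gamma> t) = (\<alpha> + \<gamma>) * h"
      using h d unfolding set_integrable_def set_lebesgue_integral_def step_def
      by (simp_all add: algebra_simps)
  qed
  have floor0: "\<lfloor>t / (2 * pi)\<rfloor> = 0" if "0 \<le> t" "t < 2 * pi" for t
    using that by (simp add: floor_eq_iff)
  have floor1: "\<lfloor>t / (2 * pi)\<rfloor> = -1" if "-pi \<le> t" "t < 0" for t
    using that by (simp add: floor_eq_iff field_simps)
  have \<phi>_right: "\<phi> t = step (1 / (2 * h)) (- 1 / (2 * h)) t" if "t \<in> {0..<2 * pi}" for t
    using that by (simp add: \<phi>_def floor0)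
  have \<phi>_mid: "\<phi> t = step (1 / (2 * h)) (- 1 / (2 * h)) t" if "t \<in> {-pi..pi}" for t
  proof (cases "t < 0")
    case True
    then show ?thesis
      using that h d floor1[of t] by (simp add: \<phi>_def step_def indicator_def)
  next
    case False
    moreover have "t < 2 * pi"
      using that pi_gt_zero unfolding atLeastAtMost_iff by linarith
    ultimately have "t \<in> {0..<2 * pi}" by simp
    then show ?thesis by (rule \<phi>_right)
  qed
  have "\<phi> (t + 2 * pi) = \<phi> t" for t
    by (simp add: \<phi>_def add_divide_distrib algebra_simps)
  then have "periodic_fun_simple \<phi> (2 * pi)"
    by unfold_locales
  moreover have "set_integrable lebesgue {0..<2 * pi} \<phi>
      \<longleftrightarrow> set_integrable lebesgue {0..<2 * pi} (step (1 / (2 * h)) (- 1 / (2 * h)))"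
    by (rule set_integrable_cong[OF refl refl \<phi>_right])
  then have "set_integrable lebesgue {0..<2 * pi} \<phi>"
    using step(1)[of "{0..<2 * pi}"] by simp
  ultimately have L1: "\<phi> \<in> L1_space"
    by (simp add: L1_space_def)
  have "\<bar>\<phi> t\<bar> = step (1 / (2 * h)) (1 / (2 * h)) t" if "t \<in> {0..<2 * pi}" for t
    using h that by (auto simp: \<phi>_right step_def indicator_def)
  then have "L1_norm \<phi> = (LINT t:{0..<2 * pi}|lebesgue. step (1 / (2 * h)) (1 / (2 * h)) t)"
    unfolding L1_norm_def by (intro set_lebesgue_integral_cong) auto
  also have "\<dots> = 1"
    using h by (subst step) auto
  finally have norm: "L1_norm \<phi> \<le> 1" by simp
  have "(LINT t:{-pi..pi}|lebesgue. \<phi> t)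
    = (LINT t:{-pi..pi}|lebesgue. step (1 / (2 * h)) (- 1 / (2 * h)) t)"
    using \<phi>_mid by (intro set_lebesgue_integral_cong) auto
  also have "\<dots> = 0"
    by (subst step) auto
  finally have mean: "(LINT t:{-pi..pi}|lebesgue. \<phi> t) = 0" .
  have "(c - c') / 2 \<le> (LINT t:{-pi..pi}|lebesgue. u t * \<phi> t)"
    if u: "continuous_on {-pi..pi} u" and A: "\<And>t. t \<in> ?A \<Longrightarrow> c \<le> u t" and B: "\<And>t. t \<in> ?B \<Longrightarrow> u t \<le> c'"
    for u c c'
  proof -
    have "(c - c') / 2 = (LINT t:{-pi..pi}|lebesgue. step (c / (2 * h)) (- c' / (2 * h)) t)"
      using h by (subst step) (auto simp: field_simps)
    also have "\<dots> \<le> (LINT t:{-pi..pi}|lebesgue. u t * \<phi> t)"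
    proof (rule set_integral_mono)
      show "set_integrable lebesgue {-pi..pi} (step (c / (2 * h)) (- c' / (2 * h)))"
        by (rule step) auto
      show "set_integrable lebesgue {-pi..pi} (\<lambda>t. u t * \<phi> t)"
        by (intro set_integrable_continuous_mult u L1_space_on_symmetric_interval L1)
      show "step (c / (2 * h)) (- c' / (2 * h)) t \<le> u t * \<phi> t" if "t \<in> {-pi..pi}" for t
        using h A B that by (auto simp: \<phi>_mid step_def indicator_def divide_right_mono)
    qed
    finally show ?thesis .
  qed
  then show ?thesis by (rule that[OF L1 norm mean])
qed

lemma abs_cos_diff_le: "\<bar>cos x - cos y\<bar> \<le> \<bar>x - y\<bar>" for x y :: real
proof -
  have "\<bar>cos x - cos y\<bar> = 2 * (\<bar>sin ((x + y) / 2)\<bar> * \<bar>sin ((y - x) / 2)\<bar>)"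
    by (simp add: cos_diff_cos abs_mult)
  also have "\<dots> \<le> 2 * (1 * \<bar>(y - x) / 2\<bar>)"
    by (intro mult_left_mono mult_mono abs_sin_le_one abs_sin_x_le_abs_x) auto
  finally show ?thesis by simp
qed

text \<open>The points where \<open>n x - \<beta> \<pi> / 2\<close> is a multiple of \<open>\<pi>\<close> are spaced by \<open>\<pi> / n\<close>, so two neighbours
  \<open>x - \<pi> / n \<le> 0 \<le> x\<close> surround the origin. At such a point the harmonic of order \<open>k + n\<close>
  equals \<open>\<plusminus> cos (k x)\<close>, with a sign that depends on the point only and alternates between
  neighbours; and \<open>cos y \<ge> 1 - \<bar>y\<bar>\<close>. Hence all harmonics of order at least \<open>n\<close> are
  simultaneously extremal at the two points, with opposite signs, up to a loss that is linear in
  \<open>k\<close>.\<close>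

lemma opposite_phase_points:
  fixes n :: nat and \<beta> :: real
  assumes "n \<ge> 1"
  obtains x \<sigma> :: real where "\<bar>\<sigma>\<bar> = 1"
    and "\<And>k. 1 - real k * x \<le> \<sigma> * cos (real (k + n) * x - \<beta> * pi / 2)"
    and "\<And>k. \<sigma> * cos (real (k + n) * (x - pi / n) - \<beta> * pi / 2) \<le> - (1 - real k * (pi / n - x))"
proof -
  \<comment> \<open>Chosen such that \<open>\<beta> / 2 + m\<close> lies in \<open>[0, 1)\<close>, hence \<open>0 \<le> x \<le> \<pi> / n\<close>.\<close>
  define m where "m = - \<lfloor>\<beta> / 2\<rfloor>"
  define x where "x = (\<beta> * pi / 2 + m * pi) / n"
  define \<sigma> where "\<sigma> = cos (m * pi)"
  have nx: "n * x = \<beta> * pi / 2 + m * pi" using assms by (simp add: x_def)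
  have sin0: "sin (m * pi) = 0"
    by (simp add: sin_integer_2pi sin_zero_iff_int2)
  have \<sigma>2: "\<sigma> * \<sigma> = 1"
    using sin_cos_squared_add3[of "m * pi"] by (simp add: \<sigma>_def sin0)
  have "0 \<le> \<beta> / 2 + m" "\<beta> / 2 + m \<le> 1"
    unfolding m_def by linarith+
  then have "0 \<le> (\<beta> / 2 + m) * pi" "(\<beta> / 2 + m) * pi \<le> 1 * pi"
    by (auto intro!: mult_right_mono)
  then have x: "0 \<le> x" "x \<le> pi / n"
    unfolding x_def by (auto simp: algebra_simps intro!: divide_right_mono)
  have phase: "real (k + n) * x - \<beta> * pi / 2 = real k * x + m * pi" for k
    using nx by (simp add: algebra_simps)
  have phase': "real (k + n) * (x - pi / n) - \<beta> * pi / 2 = real k * (x - pi / n) + m * pi - pi" for k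
    using nx assms by (simp add: algebra_simps add_divide_distrib)
  have cos_phase: "\<sigma> * cos (y + m * pi) = cos y" for y
    using \<sigma>2 by (simp add: cos_add sin0 \<sigma>_def mult.left_commute)
  have near: "1 - \<bar>y\<bar> \<le> cos y" for y :: real
    using abs_cos_diff_le[of y 0] by simp
  show ?thesis
  proof
    show "\<bar>\<sigma>\<bar> = 1" using \<sigma>2 square_eq_1_iff[of \<sigma>] by auto
    fix k
    show "1 - real k * x \<le> \<sigma> * cos (real (k + n) * x - \<beta> * pi / 2)"
      unfolding phase cos_phase using near[of "real k * x"] x by (simp add: abs_mult)
    have "\<sigma> * cos (real k * (x - pi / n) + m * pi - pi) = - cos (real k * (x - pi / n))"
      using cos_phase[of "real k * (x - pi / n)"] by (simp add: cos_diff)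
    moreover have "\<bar>real k * (x - pi / n)\<bar> = real k * (pi / n - x)"
      using x by (simp add: abs_mult)
    ultimately show "\<sigma> * cos (real (k + n) * (x - pi / n) - \<beta> * pi / 2)
        \<le> - (1 - real k * (pi / n - x))"
      unfolding phase' using near[of "real k * (x - pi / n)"] by simp
  qed
qed

text \<open>The two bumps at distance \<open>\<pi> / n\<close> average the \<open>(k+n)\<close>-th harmonic near the two points above.
  The losses at the two points, \<open>k x\<close> and \<open>k (\<pi> / n - x)\<close>, average to \<open>k \<pi> / (2n)\<close>, and the
  width \<open>h\<close> of the bumps costs at most \<open>h\<close> times the Lipschitz constant \<open>k + n\<close>.\<close>

lemma cos_moments_of_bump:
  fixes n :: nat
  assumes n: "n \<ge> 1" and h: "0 < h" "2 * h \<le> pi / n"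
  obtains \<phi> x \<sigma> where "\<phi> \<in> L1_space" "L1_norm \<phi> \<le> 1" "(LINT t:{-pi..pi}|lebesgue. \<phi> t) = 0"
    and "\<bar>\<sigma>\<bar> = 1"
    and "\<And>k. 1 - real k * pi / (2 * n) - real (k + n) * h \<le> \<sigma> * cos_moment \<beta> \<phi> (k + n) x"
proof -
  obtain \<sigma> x :: real where \<sigma>: "\<bar>\<sigma>\<bar> = 1"
    and lower: "\<And>k. 1 - real k * x \<le> \<sigma> * cos (real (k + n) * x - \<beta> * pi / 2)"
    and upper: "\<And>k. \<sigma> * cos (real (k + n) * (x - pi / n) - \<beta> * pi / 2) \<le> - (1 - real k * (pi / n - x))"
    by (rule opposite_phase_points[OF n, of \<beta>], rule that)
  have d: "pi / n \<le> pi" using n by (simp add: divide_le_eq)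
  show thesis
  proof (rule two_bump_function[OF h d])
    fix \<phi>
    assume L1: "\<phi> \<in> L1_space" "L1_norm \<phi> \<le> 1" "(LINT t:{-pi..pi}|lebesgue. \<phi> t) = 0"
      and bump: "\<And>u c c'. continuous_on {-pi..pi} u \<Longrightarrow> (\<And>t. t \<in> {0<..<h} \<Longrightarrow> c \<le> u t) \<Longrightarrow>
        (\<And>t. t \<in> {pi / n - h<..<pi / n} \<Longrightarrow> u t \<le> c') \<Longrightarrow>
        (c - c') / 2 \<le> (LINT t:{-pi..pi}|lebesgue. u t * \<phi> t)"
    have "1 - real k * pi / (2 * n) - real (k + n) * h \<le> \<sigma> * cos_moment \<beta> \<phi> (k + n) x" for k
    proof -
      let ?g = "\<lambda>y. \<sigma> * cos (real (k + n) * y - \<beta> * pi / 2)"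
      have lip: "\<bar>?g y - ?g z\<bar> \<le> real (k + n) * \<bar>y - z\<bar>" for y z
      proof -
        have "\<bar>?g y - ?g z\<bar> = \<bar>\<sigma>\<bar> * \<bar>cos (real (k + n) * y - \<beta> * pi / 2) - cos (real (k + n) * z - \<beta> * pi / 2)\<bar>"
          by (simp only: abs_mult[symmetric] right_diff_distrib)
        also have "\<dots> \<le> \<bar>(real (k + n) * y - \<beta> * pi / 2) - (real (k + n) * z - \<beta> * pi / 2)\<bar>"
          unfolding \<sigma> mult_1 by (rule abs_cos_diff_le)
        also have "\<dots> = \<bar>real (k + n) * (y - z)\<bar>"
          by (simp add: right_diff_distrib)
        finally show ?thesis by (simp only: abs_mult abs_of_nat)
      qed
      let ?c = "1 - real k * x - real (k + n) * h"
      let ?c' = "- (1 - real k * (pi / n - x)) + real (k + n) * h"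
      have "?c \<le> ?g (x - t)" if "t \<in> {0<..<h}" for t
      proof -
        have "real (k + n) * \<bar>x - t - x\<bar> \<le> real (k + n) * h"
          using that by (intro mult_left_mono) auto
        then show ?thesis using lip[of "x - t" x] lower[of k] by linarith
      qed
      moreover have "?g (x - t) \<le> ?c'" if "t \<in> {pi / n - h<..<pi / n}" for t
      proof -
        have "real (k + n) * \<bar>x - t - (x - pi / n)\<bar> \<le> real (k + n) * h"
          using that by (intro mult_left_mono) auto
        then show ?thesis using lip[of "x - t" "x - pi / n"] upper[of k] by linarith
      qed
      ultimately have "(?c - ?c') / 2 \<le> (LINT t:{-pi..pi}|lebesgue. ?g (x - t) * \<phi> t)"
        by (intro bump[where u = "\<lambda>t. ?g (x - t)"] continuous_intros)
      also have "\<dots> = \<sigma> * cos_moment \<beta> \<phi> (k + n) x"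
        by (simp add: cos_moment_def mult.assoc)
      also have "(?c - ?c') / 2 = 1 - real k * pi / (2 * n) - real (k + n) * h"
        using n by (simp add: field_simps)
      finally show ?thesis .
    qed
    then show thesis by (rule that[OF L1 \<sigma>])
  qed
qed

section \<open>The error of approximation by Fourier sums\<close>

lemma C_norm_le: "(\<And>x. \<bar>g x\<bar> \<le> M) \<Longrightarrow> C_norm g \<le> M"
  unfolding C_norm_def by (rule cSUP_least) auto

lemma abs_le_C_norm: "(\<And>x. \<bar>g x\<bar> \<le> M) \<Longrightarrow> \<bar>g x\<bar> \<le> C_norm g"
  unfolding C_norm_def by (rule cSUP_upper) (auto intro!: bdd_aboveI2)

lemma C_class_of_density:
  assumes "\<phi> \<in> L1_space" "L1_norm \<phi> \<le> 1" "(LINT t:{-pi..pi}|lebesgue. \<phi> t) = 0"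
  shows "(\<lambda>x. 1 / pi * (LINT t:{-pi..pi}|lebesgue. Psi_kernel \<psi> \<beta> (x - t) * \<phi> t)) \<in> C_class \<psi> \<beta>"
proof -
  have "cos (real (Suc k) * (y + 2 * pi) - c) = cos (real (Suc k) * y - c)" for k y c
    using cos.plus_of_nat[of "real (Suc k) * y - c" "Suc k"] by (simp add: algebra_simps)
  then have per: "Psi_kernel \<psi> \<beta> (y + 2 * pi) = Psi_kernel \<psi> \<beta> y" for y
    by (simp only: Psi_kernel_def)
  have "Psi_kernel \<psi> \<beta> (x + 2 * pi - t) = Psi_kernel \<psi> \<beta> (x - t)" for x t
    using per[of "x - t"] by (simp add: algebra_simps)
  then show ?thesis
    unfolding C_class_def using assms
    by (auto intro!: exI[of _ 0] exI[of _ \<phi>] simp: periodic_fun_simple_def)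
qed

theorem mainTheorem2:
  fixes \<psi> :: "nat \<Rightarrow> real" and \<beta> :: real
  assumes "\<And>k. k \<ge> 1 \<Longrightarrow> \<psi> k \<ge> 0"
    and "summable (\<lambda>k. real (Suc k) * \<psi> (Suc k))"
  shows "\<forall>n\<ge>1. \<exists>\<Theta>\<^sub>2. -1 \<le> \<Theta>\<^sub>2 \<and> \<Theta>\<^sub>2 \<le> 0 \<and>
    fourier_error n (C_class \<psi> \<beta>) =
      ereal (1 / pi * (\<Sum>k. \<psi> (k + n)) + \<Theta>\<^sub>2 / real n * (\<Sum>k. real (Suc k) * \<psi> (Suc k + n)))"
proof (intro allI impI)
  fix n :: nat
  assume n: "n \<ge> 1"
  define E where "E = fourier_error n (C_class \<psi> \<beta>)"
  define S where "S = (\<Sum>k. \<psi> (k + n))"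
  define T where "T = (\<Sum>k. real (Suc k) * \<psi> (Suc k + n))"
  define L where "L = (\<Sum>k. real (k + n) * \<psi> (k + n))"
  have nonneg: "\<psi> (Suc k) \<ge> 0" "\<psi> (k + n) \<ge> 0" for k
    using assms(1) n by simp_all
  have sum1: "summable (\<lambda>k. real k * \<psi> k)"
    using assms(2) summable_Suc_iff[of "\<lambda>k. real k * \<psi> k"] by simp
  have sum: "summable (\<lambda>k. \<psi> (Suc k))"
    by (rule summable_comparison_test'[OF assms(2), of 0])
       (use nonneg in \<open>auto simp: mult_le_cancel_right1 algebra_simps\<close>)
  have sumS: "summable (\<lambda>k. \<psi> (k + n))"
    using sum by (simp add: summable_iff_shift summable_Suc_iff)
  have sumL: "summable (\<lambda>k. real (k + n) * \<psi> (k + n))"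
    using summable_ignore_initial_segment[OF sum1, of n] .
  have sumT: "summable (\<lambda>k. real k * \<psi> (k + n))"
    by (rule summable_comparison_test'[OF sumL, of 0])
       (use nonneg in \<open>auto simp: abs_mult intro!: mult_right_mono\<close>)
  \<comment> \<open>The sum may start at the vanishing term \<open>k = 0\<close>, which aligns it with the harmonics.\<close>
  have T: "T = (\<Sum>k. real k * \<psi> (k + n))"
    using suminf_split_head[OF sumT] by (simp add: T_def)
  have T0: "T \<ge> 0"
    unfolding T using sumT nonneg by (intro suminf_nonneg) auto

  let ?R = "\<lambda>f x. f x - fourier_sum (n - 1) f x"
  have repr: "?R f x = 1 / pi * (\<Sum>k. \<psi> (k + n) * cos_moment \<beta> \<phi> (k + n) x)"
    if "\<phi> \<in> L1_space"
      "\<And>x. f x = a0 / 2 + 1 / pi * (LINT t:{-pi..pi}|lebesgue. Psi_kernel \<psi> \<beta> (x - t) * \<phi> t)"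
    for f \<phi> a0 x
    using that by (intro fourier_remainder nonneg sum n L1_space_on_symmetric_interval)
  have moment_le: "\<bar>\<psi> (k + n) * cos_moment \<beta> \<phi> (k + n) x\<bar> \<le> \<psi> (k + n)"
    if "\<phi> \<in> L1_space" "L1_norm \<phi> \<le> 1" for \<phi> k x
  proof -
    have "\<bar>cos_moment \<beta> \<phi> (k + n) x\<bar> \<le> 1"
      using abs_cos_moment_le L1_space_on_symmetric_interval[OF that(1)] that(2) by (metis order_trans)
    then show ?thesis using nonneg(2)[of k] by (simp add: abs_mult mult_left_le)
  qed
  have summ: "summable (\<lambda>k. \<psi> (k + n) * cos_moment \<beta> \<phi> (k + n) x)"
    if "\<phi> \<in> L1_space" "L1_norm \<phi> \<le> 1" for \<phi> x
    by (rule summable_comparison_test'[OF sumS, of 0]) (use moment_le[OF that] in simp)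
  have R_le: "\<bar>?R f x\<bar> \<le> 1 / pi * S" if f: "f \<in> C_class \<psi> \<beta>" for f x
  proof -
    obtain a0 \<phi> where \<phi>: "\<phi> \<in> L1_space" "L1_norm \<phi> \<le> 1"
      and f_eq: "\<And>x. f x = a0 / 2 + 1 / pi * (LINT t:{-pi..pi}|lebesgue. Psi_kernel \<psi> \<beta> (x - t) * \<phi> t)"
      using f unfolding C_class_def
      by (elim CollectE conjE exE) (rule that, assumption, assumption, erule spec)
    have "\<bar>\<Sum>k. \<psi> (k + n) * cos_moment \<beta> \<phi> (k + n) x\<bar> \<le> S"
      unfolding S_def real_norm_def[symmetric]
      by (rule norm_suminf_le[OF _ sumS]) (simp only: real_norm_def moment_le[OF \<phi>])
    then show ?thesis
      unfolding repr[OF \<phi>(1) f_eq] by (simp add: abs_mult divide_right_mono)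
  qed

  have upper: "E \<le> ereal (1 / pi * S)"
    unfolding E_def fourier_error_def
    by (intro SUP_least) (use R_le in \<open>auto intro: C_norm_le\<close>)
  have lower: "ereal (1 / pi * (S - pi / (2 * n) * T - h * L)) \<le> E" if h: "0 < h" "2 * h \<le> pi / n" for h
  proof -
    obtain \<phi> x \<sigma> where \<phi>: "\<phi> \<in> L1_space" "L1_norm \<phi> \<le> 1" "(LINT t:{-pi..pi}|lebesgue. \<phi> t) = 0"
      and \<sigma>: "\<bar>\<sigma>\<bar> = 1"
      and mom: "\<And>k. 1 - real k * pi / (2 * n) - real (k + n) * h \<le> \<sigma> * cos_moment \<beta> \<phi> (k + n) x"
      using cos_moments_of_bump[OF n h] by metis
    define f where "f x = 1 / pi * (LINT t:{-pi..pi}|lebesgue. Psi_kernel \<psi> \<beta> (x - t) * \<phi> t)" for x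
    have f: "f \<in> C_class \<psi> \<beta>"
      unfolding f_def using C_class_of_density[OF \<phi>] .
    let ?m = "\<lambda>k. \<psi> (k + n) * cos_moment \<beta> \<phi> (k + n) x"
    let ?l = "\<lambda>k. \<psi> (k + n) - pi / (2 * n) * (real k * \<psi> (k + n)) - h * (real (k + n) * \<psi> (k + n))"
    have l: "?l sums (S - pi / (2 * n) * T - h * L)"
      unfolding S_def T L_def by (intro sums_diff sums_mult summable_sums sumS sumT sumL)
    have m: "(\<lambda>k. \<sigma> * ?m k) sums (\<sigma> * (\<Sum>k. ?m k))"
      by (intro sums_mult summable_sums summ \<phi>)
    have "?l k \<le> \<sigma> * ?m k" for k
      using mult_left_mono[OF mom[of k] nonneg(2)[of k]] by (simp add: algebra_simps)
    then have "S - pi / (2 * n) * T - h * L \<le> \<sigma> * (\<Sum>k. ?m k)"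
      by (rule sums_le[OF _ l m])
    also have "\<dots> \<le> \<bar>\<Sum>k. ?m k\<bar>"
      using \<sigma> abs_ge_self[of "\<sigma> * (\<Sum>k. ?m k)"] by (simp only: abs_mult)
    finally have "1 / pi * (S - pi / (2 * n) * T - h * L) \<le> 1 / pi * \<bar>\<Sum>k. ?m k\<bar>"
      by (intro mult_left_mono) auto
    also have "\<dots> = \<bar>?R f x\<bar>"
      by (subst repr[OF \<phi>(1), of f 0]) (simp_all add: f_def abs_mult)
    also have "\<dots> \<le> C_norm (?R f)"
      using abs_le_C_norm[of "?R f"] R_le[OF f] by blast
    finally have "ereal (1 / pi * (S - pi / (2 * n) * T - h * L)) \<le> ereal (C_norm (?R f))"
      by simp
    also have "\<dots> \<le> E"
      unfolding E_def fourier_error_def by (rule SUP_upper[OF f])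
    finally show ?thesis .
  qed

  have small: "pi / (4 * n) > 0" "2 * (pi / (4 * n)) \<le> pi / n"
    using n by (auto simp: field_simps)
  obtain e where e: "E = ereal e"
    using lower[OF small] upper by (cases E) auto
  \<comment> \<open>Letting the width of the bumps tend to 0.\<close>
  have "1 / pi * (S - pi / (2 * n) * T - 0 * L) \<le> e"
  proof (rule tendsto_upperbound)
    show "((\<lambda>h. 1 / pi * (S - pi / (2 * n) * T - h * L))
        \<longlongrightarrow> 1 / pi * (S - pi / (2 * n) * T - 0 * L)) (at_right 0)"
      by (intro tendsto_intros)
    show "\<forall>\<^sub>F h in at_right 0. 1 / pi * (S - pi / (2 * n) * T - h * L) \<le> e"
      using eventually_at_right_real[OF small(1)]
    proof eventually_elim
      case (elim h)
      then have "0 < h" "2 * h \<le> pi / n"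
        using small(2) by auto
      from lower[OF this] show ?case by (simp add: e)
    qed
  qed simp
  then have lo: "1 / pi * S - T / (2 * n) \<le> e"
    by (simp add: field_simps)
  have up: "e \<le> 1 / pi * S"
    using upper by (simp add: e)
  \<comment> \<open>If \<open>T = 0\<close>, the two bounds on \<open>e\<close> coincide, so \<open>\<Theta> = 0\<close> is correct there.\<close>
  define \<Theta> where "\<Theta> = (if T = 0 then 0 else n * (e - 1 / pi * S) / T)"
  have "e = 1 / pi * S + \<Theta> / n * T"
    using lo up n by (auto simp: \<Theta>_def)
  moreover have "-1 \<le> \<Theta>"
  proof -
    have "T / (2 * n) \<le> T / n"
      using T0 n by (intro divide_left_mono) auto
    with lo have "- (T / n) \<le> e - 1 / pi * S"
      by linarith
    then show ?thesis
      using T0 n by (auto simp: \<Theta>_def field_simps)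
  qed
  moreover have "\<Theta> \<le> 0"
    using up T0 n by (auto simp: \<Theta>_def divide_nonpos_pos mult_nonneg_nonpos)
  ultimately show "\<exists>\<Theta>\<^sub>2. -1 \<le> \<Theta>\<^sub>2 \<and> \<Theta>\<^sub>2 \<le> 0 \<and>
    fourier_error n (C_class \<psi> \<beta>) =
      ereal (1 / pi * (\<Sum>k. \<psi> (k + n)) + \<Theta>\<^sub>2 / real n * (\<Sum>k. real (Suc k) * \<psi> (Suc k + n)))"
    using e unfolding E_def S_def T_def by auto
qed

end
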